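(* For integers $n\ge1$ and $q\ge0$, \[ \sum_{\substack{r+s=n\\ r,s\ge0}}\ \sum_{\substack{\alpha_1+\cdots+\alpha_{r+1}=q\\ \alpha_i\ge0}}\eta(\alpha_1+1,\ldots,\alpha_r+1,\alpha_{r+1}+2,\{1\}^s)=\frac{P_{q+1}\bigl(H_n^{(1)},\ldots,H_n^{(q+1)}\bigr)}{n\cdot n!}. \]
   Context: For positive integers $\beta_1,\ldots,\beta_k$ with $\beta_1+\cdots+\beta_k>1$, $\eta(\beta_1,\ldots,\beta_k)=\sum_{n=1}^\infty\frac{1}{n^{\beta_1}(n+1)^{\beta_2}\cdots(n+k-1)^{\beta_k}}$. The notation $\{1\}^s$ denotes $s$ consecutive arguments equal to $1$. $H_n^{(m)}=\sum_{j=1}^n j^{-m}$. The polynomials $P_m$ are defined by $\exp\bigl(\sum_{k\ge1}\frac{t_k}{k}z^k\bigr)=\sum_{m\ge0}P_m(t_1,\ldots,t_m)z^m$, i.e. $P_m(t_1,\ldots,t_m)=\sum_{k_1+2k_2+\cdots+mk_m=m,\,k_i\ge0}\prod_{i=1}^m\frac{1}{k_i!}\left(\frac{t_i}{i}\right)^{k_i}$. *)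

theory Defs
  imports "HOL-Analysis.Analysis" "HOL-Computational_Algebra.Formal_Power_Series"
begin

text \<open>
  The argument list \<open>b = [\<beta>\<^sub>1, \<dots>, \<beta>\<^sub>k]\<close> is 0-indexed, and the summation variable is shifted by one,
  so that \<open>n + 1 + i\<close> carries the exponent \<open>b ! i = \<beta>\<^sub>i\<^sub>+\<^sub>1\<close>.  The value is meaningful only for
  convergent series; \<open>summable_eta\<close> covers all admissible arguments.
\<close>

definition eta :: "nat list \<Rightarrow> real" where
  "eta b = (\<Sum>n. 1 / (\<Prod>i<length b. real (n + 1 + i) ^ (b ! i)))"

lemma summable_eta:
  assumes "sum_list b > 1"
  shows "summable (\<lambda>n. 1 / (\<Prod>i<length b. real (n + 1 + i) ^ (b ! i)))"
proof (rule summable_comparison_test')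
  show "summable (\<lambda>n. 1 / real (Suc n) ^ 2)"
    using inverse_power_summable[of 2, where ?'a = real]
    by (subst summable_Suc_iff) (simp add: inverse_eq_divide)
  fix n :: nat
  have "real (Suc n) ^ 2 \<le> real (Suc n) ^ sum_list b"
    using assms by (intro power_increasing) auto
  also have "\<dots> = (\<Prod>i<length b. real (Suc n) ^ (b ! i))"
    by (simp add: sum_list_sum_nth power_sum atLeast0LessThan)
  also have "\<dots> \<le> (\<Prod>i<length b. real (n + 1 + i) ^ (b ! i))"
    by (intro prod_mono conjI power_mono) auto
  finally show "norm (1 / (\<Prod>i<length b. real (n + 1 + i) ^ (b ! i))) \<le> 1 / real (Suc n) ^ 2"
    by (simp add: prod_nonneg frac_le)
qed

definition gen_harm :: "nat \<Rightarrow> nat \<Rightarrow> real" where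
  "gen_harm n m = (\<Sum>j=1..n. 1 / real j ^ m)"

text \<open>
  The variables \<open>t\<^sub>1, t\<^sub>2, \<dots>\<close> are given as a function on the positive naturals (the value \<open>t 0\<close> is ignored).
  That \<open>P m t\<close> is a polynomial in \<open>t 1, \<dots>, t m\<close> only is shown by \<open>P_explicit\<close>.
\<close>

definition P :: "nat \<Rightarrow> (nat \<Rightarrow> real) \<Rightarrow> real" where
  "P m t = fps_nth (fps_exp 1 oo Abs_fps (\<lambda>k. if k = 0 then 0 else t k / real k)) m"

lemma P_0: "P 0 t = 1"
  by (simp add: P_def)

lemma P_rec: "real m * P m t = (\<Sum>i=1..m. t i * P (m - i) t)"
proof (cases m)
  case (Suc l)
  define f where "f = Abs_fps (\<lambda>k. if k = 0 then 0 else t k / real k)"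
  have "fps_deriv (fps_exp 1 oo f) = (fps_exp 1 oo f) * fps_deriv f"
    by (subst fps_compose_deriv) (simp_all add: f_def)
  hence "fps_nth (fps_deriv (fps_exp 1 oo f)) l =
      (\<Sum>i=0..l. fps_nth (fps_deriv f) i * fps_nth (fps_exp 1 oo f) (l - i))"
    by (simp add: fps_mult_nth mult.commute[of "fps_exp 1 oo f"])
  also have "\<dots> = (\<Sum>i=0..l. t (Suc i) * P (m - Suc i) t)"
    unfolding P_def f_def[symmetric] by (intro sum.cong) (simp_all add: f_def Suc)
  also have "\<dots> = (\<Sum>i=Suc 0..Suc l. t i * P (m - i) t)"
    by (rule sum.shift_bounds_cl_Suc_ivl[symmetric])
  finally show ?thesis
    by (simp add: P_def f_def[symmetric] Suc)
qed simp

theorem P_explicit: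
  "P m t = (\<Sum>k | (\<forall>i. i \<notin> {1..m} \<longrightarrow> k i = 0) \<and> (\<Sum>i=1..m. i * k i) = m.
              \<Prod>i=1..m. 1 / fact (k i) * (t i / real i) ^ k i)"
proof -
  define N where "N = m"
  define S :: "nat \<Rightarrow> (nat \<Rightarrow> nat) set"
    where "S m = {k. (\<forall>i. i \<notin> {1..N} \<longrightarrow> k i = 0) \<and> (\<Sum>i=1..N. i * k i) = m}" for m
  define w where "w k = (\<Prod>i=1..N. 1 / fact (k i) * (t i / real i) ^ k i)" for k :: "nat \<Rightarrow> nat"
  have le: "i * k i \<le> m" if "k \<in> S m" "i \<in> {1..N}" for k m i
    using that member_le_sum[of i "{1..N}" "\<lambda>i. i * k i"] by (simp add: S_def)
  have le': "k i \<le> m" if "k \<in> S m" "i \<in> {1..N}" for k m i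
  proof -
    have "k i \<le> i * k i" using that by simp
    with le[OF that] show ?thesis by linarith
  qed
  have fin: "finite (S m)" for m
  proof (rule finite_subset)
    show "S m \<subseteq> {k. (\<forall>i. (i \<in> {1..N} \<longrightarrow> k i \<in> {..m}) \<and> (i \<notin> {1..N} \<longrightarrow> k i = 0))}"
      using le' unfolding S_def by blast
  qed (rule finite_set_of_finite_funs, auto)
  have upd: "(\<Sum>j=1..N. j * (k(i := x)) j) + i * k i = (\<Sum>j=1..N. j * k j) + i * x"
    if "i \<in> {1..N}" for k :: "nat \<Rightarrow> nat" and i x
    using that by (simp add: sum.remove[of _ i])
  have part: "(\<Sum>k\<in>S m. real (i * k i) * w k) = (if i \<le> m then t i * (\<Sum>k\<in>S (m - i). w k) else 0)"
    if i: "i \<in> {1..N}" for m i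
  proof (cases "i \<le> m")
    case True
    have "(\<Sum>k\<in>S m. real (i * k i) * w k) = (\<Sum>k\<in>{k \<in> S m. k i > 0}. real (i * k i) * w k)"
      by (rule sum.mono_neutral_right) (auto simp: fin)
    also have "\<dots> = (\<Sum>k\<in>S (m - i). t i * w k)"
    proof (rule sum.reindex_bij_witness[where j = "\<lambda>k. k(i := k i - 1)" and i = "\<lambda>k. k(i := Suc (k i))"])
      fix k assume k: "k \<in> {k \<in> S m. k i > 0}"
      have "(\<Sum>j=1..N. j * (k(i := k i - 1)) j) + i * k i = m + i * (k i - 1)"
        using upd[OF i, of k "k i - 1"] k by (simp add: S_def)
      moreover have "i * k i = i * (k i - 1) + i"
        using k by (cases "k i") auto
      ultimately show "k(i := k i - 1) \<in> S (m - i)"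
        using k i by (auto simp: S_def)
      obtain l where l: "k i = Suc l" using k by (cases "k i") auto
      define A where "A = (\<Prod>j\<in>{1..N}-{i}. 1 / fact (k j) * (t j / real j) ^ k j)"
      have w1: "w k = 1 / fact (Suc l) * (t i / real i) ^ Suc l * A"
        unfolding w_def A_def l[symmetric] using i by (intro prod.remove) auto
      have w2: "w (k(i := l)) = 1 / fact l * (t i / real i) ^ l * A"
        unfolding w_def A_def using i by (subst prod.remove[of _ i]) auto
      have "real (i * Suc l) * (1 / fact (Suc l) * (t i / real i) ^ Suc l)
              = t i * (1 / fact l * (t i / real i) ^ l)"
        using i by (simp add: divide_simps del: of_nat_Suc) (simp add: algebra_simps)
      from arg_cong[OF this[symmetric], of "\<lambda>x. x * A"]
      show "t i * w (k(i := k i - 1)) = real (i * k i) * w k"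
        by (simp only: l w1 w2 mult.assoc diff_Suc_1)
    next
      fix k assume k: "k \<in> S (m - i)"
      show "k(i := Suc (k i)) \<in> {k \<in> S m. k i > 0}"
        using upd[OF i, of k "Suc (k i)"] k i True by (auto simp: S_def)
    qed auto
    finally show ?thesis using True by (simp add: sum_distrib_left)
  next
    case False
    have "k i = 0" if "k \<in> S m" for k
      using le[OF that i] False by (cases "k i") auto
    hence "(\<Sum>k\<in>S m. real (i * k i) * w k) = 0"
      by (intro sum.neutral) auto
    with False show ?thesis by simp
  qed
  have rec: "real m * (\<Sum>k\<in>S m. w k) = (\<Sum>i=1..m. t i * (\<Sum>k\<in>S (m - i). w k))" if "m \<le> N" for m
  proof -
    have "real m * (\<Sum>k\<in>S m. w k) = (\<Sum>k\<in>S m. (\<Sum>i=1..N. real (i * k i)) * w k)"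
      unfolding sum_distrib_left
      by (intro sum.cong refl) (auto simp: S_def simp flip: of_nat_sum simp del: of_nat_mult)
    also have "\<dots> = (\<Sum>i=1..N. \<Sum>k\<in>S m. real (i * k i) * w k)"
      by (simp only: sum_distrib_right) (rule sum.swap)
    also have "\<dots> = (\<Sum>i=1..N. if i \<le> m then t i * (\<Sum>k\<in>S (m - i). w k) else 0)"
      by (intro sum.cong refl part)
    also have "\<dots> = (\<Sum>i=1..m. t i * (\<Sum>k\<in>S (m - i). w k))"
      using that by (intro sum.mono_neutral_cong_right) auto
    finally show ?thesis .
  qed
  have "P m t = (\<Sum>k\<in>S m. w k)" if "m \<le> N" for m
    using that
  proof (induction m rule: less_induct)
    case (less m)
    show ?case
    proof (cases "m = 0")
      case True
      have "S 0 = {\<lambda>_. 0}" by (auto simp: S_def fun_eq_iff) (metis atLeastAtMost_iff)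
      thus ?thesis by (simp add: True P_0 w_def)
    next
      case False
      have "real m * P m t = (\<Sum>i=1..m. t i * (\<Sum>k\<in>S (m - i). w k))"
        unfolding P_rec using less False by (intro sum.cong refl) auto
      also have "\<dots> = real m * (\<Sum>k\<in>S m. w k)"
        using rec[OF less.prems] by (rule sym)
      finally show ?thesis using False by (metis mult_cancel_left of_nat_eq_0_iff)
    qed
  qed
  from this[of N] show ?thesis
    by (simp add: S_def w_def N_def)
qed

end

theory Submission
  imports Defs
begin

text \<open>
  Pass to generating functions in \<open>q\<close>.  For a fixed summation index of \<open>\<eta>\<close>, with denominator
  factors \<open>y\<^sub>0, \<dots>, y\<^sub>n\<close>, the inner sum becomes
  \<open>\<Prod>i<r. 1/(y\<^sub>i - z)\<close> times \<open>1/(y\<^sub>r (y\<^sub>r - z))\<close> times \<open>\<Prod>i>r. 1/y\<^sub>i\<close>.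
  As \<open>z/(y(y - z)) = 1/(y - z) - 1/y\<close>, the sum over \<open>r\<close> telescopes to the coefficient of \<open>z\<^bsup>q+1\<^esup>\<close> in
  \<open>\<Prod>i\<le>n. 1/(y\<^sub>i - z)\<close>.  For \<open>y\<^sub>i = m + i\<close> this product is \<open>1/n\<close> times a difference of
  consecutive values of \<open>\<Prod>i<n. 1/(m + i - z)\<close>, so the sum over \<open>m \<ge> 1\<close> telescopes too and leaves
  \<open>1/n\<close> times the coefficient in \<open>\<Prod>j=1..n. 1/(j - z)\<close>, whose logarithmic derivative
  generates the power sums \<open>H\<^sub>n\<^sup>(\<^sup>m\<^sup>)\<close>.
\<close>

text \<open>The geometric expansion of \<open>1/(x - z)\<close> about \<open>z = 0\<close>,
  meaningful for \<open>x \<noteq> 0\<close>.\<close>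

definition fps_recip_linear :: "real \<Rightarrow> real fps" where
  "fps_recip_linear x = Abs_fps (\<lambda>k. 1 / x ^ Suc k)"

lemma fps_recip_linear_nth [simp]: "fps_nth (fps_recip_linear x) k = 1 / x ^ Suc k"
  by (simp add: fps_recip_linear_def)

lemma fps_nth_0_prod:
  fixes f :: "'a \<Rightarrow> 'b :: comm_ring_1 fps"
  shows "fps_nth (prod f A) 0 = (\<Prod>i\<in>A. fps_nth (f i) 0)"
  by (induction A rule: infinite_finite_induct) simp_all

lemma fps_recip_linear_mult:
  assumes "x \<noteq> 0"
  shows "fps_recip_linear x * (fps_const x - fps_X) = 1"
proof (rule fps_ext)
  fix k
  show "fps_nth (fps_recip_linear x * (fps_const x - fps_X)) k = fps_nth 1 k"
    using assms by (cases k) (simp_all add: right_diff_distrib fps_recip_linear_def)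
qed

lemma fps_X_mult_recip_linear:
  assumes "x \<noteq> 0"
  shows "fps_X * (fps_const (1 / x) * fps_recip_linear x) = fps_recip_linear x - fps_const (1 / x)"
proof (rule fps_ext)
  fix k
  show "fps_nth (fps_X * (fps_const (1 / x) * fps_recip_linear x)) k
          = fps_nth (fps_recip_linear x - fps_const (1 / x)) k"
    using assms by (cases k) (simp_all add: fps_recip_linear_def)
qed

lemma fps_deriv_recip_linear:
  assumes "x \<noteq> 0"
  shows "fps_deriv (fps_recip_linear x) = fps_recip_linear x * fps_recip_linear x"
proof -
  define F where "F = fps_recip_linear x"
  have F: "F * (fps_const x - fps_X) = 1"
    using fps_recip_linear_mult[OF assms] by (simp add: F_def)
  \<comment> \<open>The derivative of the constant 1 vanishes; multiplying by \<open>F\<close>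
    afterwards cancels the linear factor.\<close>
  from arg_cong[OF this, of fps_deriv] have "fps_deriv F * (fps_const x - fps_X) = F"
    by (simp add: algebra_simps)
  hence "fps_deriv F * (F * (fps_const x - fps_X)) = F * F"
    by (metis mult.assoc mult.commute)
  thus ?thesis by (simp add: F F_def[symmetric])
qed

lemma fps_deriv_prod_recip_linear:
  assumes "finite A" "\<And>i. i \<in> A \<Longrightarrow> y i \<noteq> 0"
  shows "fps_deriv (\<Prod>i\<in>A. fps_recip_linear (y i))
           = (\<Sum>i\<in>A. fps_recip_linear (y i)) * (\<Prod>i\<in>A. fps_recip_linear (y i))"
  using assms
  by (induction A rule: finite_induct) (simp_all add: fps_deriv_recip_linear algebra_simps)

text \<open>The coefficients obey the recurrence \<open>P_rec\<close>: the product has logarithmic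
  derivative \<open>\<Sum>j=1..n. 1/(j - z)\<close>, whose coefficient of \<open>z^i\<close> is
  \<open>gen_harm n (Suc i)\<close>. The constant term supplies the factor
  \<open>1 / fact n\<close>.\<close>

lemma prod_recip_linear_nth_eq_P:
  "fps_nth (\<Prod>j=1..n. fps_recip_linear (real j)) k = P k (gen_harm n) / fact n"
proof (induction k rule: less_induct)
  case (less k)
  define A where "A = (\<Prod>j=1..n. fps_recip_linear (real j))"
  define S where "S = (\<Sum>j=1..n. fps_recip_linear (real j))"
  have S: "fps_nth S i = gen_harm n (Suc i)" for i
    by (simp add: S_def gen_harm_def fps_sum_nth)
  show ?case
  proof (cases k)
    case 0
    have "fps_nth A 0 = (\<Prod>j=1..n. 1 / real j)"
      by (simp add: A_def fps_nth_0_prod)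
    also have "\<dots> = 1 / fact n"
      by (simp add: prod_dividef fact_prod)
    finally show ?thesis by (simp add: 0 P_0 A_def)
  next
    case (Suc l)
    have "fps_deriv A = S * A"
      unfolding A_def S_def by (rule fps_deriv_prod_recip_linear) auto
    from arg_cong[OF this, of "\<lambda>f. fps_nth f l"]
    have "real k * fps_nth A k = (\<Sum>i=0..l. gen_harm n (Suc i) * fps_nth A (l - i))"
      by (simp add: Suc fps_mult_nth S)
    also have "\<dots> = (\<Sum>i=0..l. gen_harm n (Suc i) * (P (k - Suc i) (gen_harm n) / fact n))"
      using less unfolding A_def by (intro sum.cong) (auto simp: Suc)
    also have "\<dots> = (\<Sum>i=Suc 0..Suc l. gen_harm n i * (P (k - i) (gen_harm n) / fact n))"
      by (rule sum.shift_bounds_cl_Suc_ivl[symmetric])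
    also have "\<dots> = (\<Sum>i=1..k. gen_harm n i * P (k - i) (gen_harm n)) / fact n"
      by (simp only: Suc sum_divide_distrib times_divide_eq_right One_nat_def)
    also have "\<dots> = real k * (P k (gen_harm n) / fact n)"
      by (simp only: P_rec[symmetric] times_divide_eq_right)
    finally have "real k * fps_nth A k = real k * (P k (gen_harm n) / fact n)" .
    thus ?thesis unfolding A_def Suc by (metis mult_left_cancel of_nat_eq_0_iff nat.distinct(2))
  qed
qed

text \<open>Write \<open>y n - y 0\<close> as \<open>(y n - z) - (y 0 - z)\<close>: the first term
  cancels the last factor of the product, the second cancels the first factor.\<close>

lemma prod_recip_linear_difference:
  assumes "\<And>i. y i \<noteq> 0"
  shows "fps_const (y n - y 0) * (\<Prod>i<Suc n. fps_recip_linear (y i))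
           = (\<Prod>i<n. fps_recip_linear (y i)) - (\<Prod>i<n. fps_recip_linear (y (Suc i)))"
proof -
  define F where "F i = fps_recip_linear (y i)" for i
  have F: "F i * (fps_const (y i) - fps_X) = 1" for i
    using fps_recip_linear_mult[OF assms] by (simp add: F_def)
  have "fps_const (y n - y 0) * (\<Prod>i<Suc n. F i)
          = (\<Prod>i<Suc n. F i) * (fps_const (y n) - fps_X) - (\<Prod>i<Suc n. F i) * (fps_const (y 0) - fps_X)"
    by (simp only: algebra_simps fps_const_sub[symmetric])
  also have "(\<Prod>i<Suc n. F i) * (fps_const (y n) - fps_X) = (\<Prod>i<n. F i)"
    by (simp add: mult.assoc F)
  also have "(\<Prod>i<Suc n. F i) * (fps_const (y 0) - fps_X)
      = (F 0 * (fps_const (y 0) - fps_X)) * (\<Prod>i<n. F (Suc i))"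
    by (simp only: prod.lessThan_Suc_shift mult_ac)
  finally show ?thesis by (simp only: F mult_1_left F_def[symmetric])
qed

lemma sum_prod_recip_linear:
  assumes "\<And>i. y i \<noteq> 0"
  shows "(\<Sum>r\<le>n. fps_nth ((\<Prod>i<r. fps_recip_linear (y i)) * (fps_const (1 / y r) * fps_recip_linear (y r))
                    * fps_const (\<Prod>i\<in>{r<..n}. 1 / y i)) q)
           = fps_nth (\<Prod>i<Suc n. fps_recip_linear (y i)) (Suc q)"
proof -
  define F where "F i = fps_recip_linear (y i)" for i
  define T where "T r = (\<Prod>i<r. F i) * (fps_const (1 / y r) * F r) * fps_const (\<Prod>i\<in>{r<..n}. 1 / y i)" for r
  \<comment> \<open>\<open>U r\<close> interpolates between the full product and its constant term:
    the factors from index \<open>r\<close> on are evaluated at \<open>z = 0\<close>.\<close>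
  define U where "U r = (\<Prod>i<r. F i) * fps_const (\<Prod>i\<in>{r..n}. 1 / y i)" for r
  have step: "fps_X * T r = U (Suc r) - U r" if "r \<le> n" for r
  proof -
    have "{r..n} = insert r {r<..n}" using that by auto
    hence split: "(\<Prod>i\<in>{r..n}. 1 / y i) = 1 / y r * (\<Prod>i\<in>{r<..n}. 1 / y i)" by simp
    have "fps_X * T r = (\<Prod>i<r. F i) * (fps_X * (fps_const (1 / y r) * F r)) * fps_const (\<Prod>i\<in>{r<..n}. 1 / y i)"
      by (simp add: T_def mult_ac)
    also have "fps_X * (fps_const (1 / y r) * F r) = F r - fps_const (1 / y r)"
      unfolding F_def by (rule fps_X_mult_recip_linear[OF assms])
    also have "(\<Prod>i<r. F i) * (F r - fps_const (1 / y r)) * fps_const (\<Prod>i\<in>{r<..n}. 1 / y i) = U (Suc r) - U r"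
      by (simp add: U_def split fps_const_mult[symmetric] algebra_simps
            atLeastSucAtMost_greaterThanAtMost del: fps_const_mult)
    finally show ?thesis .
  qed
  \<comment> \<open>Multiplication by \<open>fps_X\<close> moves the coefficient from
    \<open>q\<close> to \<open>Suc q\<close>, where the constant series \<open>U 0\<close>
    contributes nothing.\<close>
  have "fps_X * (\<Sum>r\<le>n. T r) = (\<Sum>r<Suc n. U (Suc r) - U r)"
    by (simp add: sum_distrib_left lessThan_Suc_atMost step cong: sum.cong_simp)
  also have "\<dots> = U (Suc n) - U 0"
    by (rule sum_lessThan_telescope)
  finally have "fps_nth (fps_X * (\<Sum>r\<le>n. T r)) (Suc q) = fps_nth (U (Suc n) - U 0) (Suc q)"
    by simp
  thus ?thesis by (simp add: U_def T_def F_def fps_sum_nth)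
qed

text \<open>Each coefficient of a product is a finite convolution, so null coefficients persist when
  a factor is added. One factor is needed to start, since the empty product is 1.\<close>

lemma prod_recip_linear_tendsto_0:
  assumes "n > 0"
  shows "(\<lambda>m. fps_nth (\<Prod>i<n. fps_recip_linear (real (m + 1 + i))) k) \<longlonglongrightarrow> 0"
  using assms
proof (induction n arbitrary: k rule: nat_induct_non_zero)
  have lim: "(\<lambda>m. fps_nth (fps_recip_linear (real (m + 1 + i))) k) \<longlonglongrightarrow> 0" for i k
  proof -
    have "(\<lambda>m. (1 / real (m + Suc i)) ^ Suc k) \<longlonglongrightarrow> 0 ^ Suc k"
      by (intro tendsto_power LIMSEQ_ignore_initial_segment lim_1_over_n)
    thus ?thesis by (simp add: power_one_over field_simps)
  qed
  show "(\<lambda>m. fps_nth (\<Prod>i<1. fps_recip_linear (real (m + 1 + i))) k) \<longlonglongrightarrow> 0" for k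
    using lim[of 0 k] by simp
  fix n k
  assume IH: "\<And>k. (\<lambda>m. fps_nth (\<Prod>i<n. fps_recip_linear (real (m + 1 + i))) k) \<longlonglongrightarrow> 0"
  have "(\<lambda>m. \<Sum>j=0..k. fps_nth (\<Prod>i<n. fps_recip_linear (real (m + 1 + i))) j
            * fps_nth (fps_recip_linear (real (m + 1 + n))) (k - j)) \<longlonglongrightarrow> (\<Sum>j=0..k. 0 * 0)"
    by (intro tendsto_sum tendsto_mult IH lim)
  thus "(\<lambda>m. fps_nth (\<Prod>i<Suc n. fps_recip_linear (real (m + 1 + i))) k) \<longlonglongrightarrow> 0"
    by (simp add: fps_mult_nth)
qed

lemma sums_prod_recip_linear:
  assumes "n > 0"
  shows "(\<lambda>m. fps_nth (\<Prod>i<Suc n. fps_recip_linear (real (m + 1 + i))) k)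
           sums (P k (gen_harm n) / (real n * fact n))"
proof -
  define B where "B m = fps_nth (\<Prod>i<n. fps_recip_linear (real (m + 1 + i))) k" for m
  \<comment> \<open>Here \<open>y n - y 0\<close> is \<open>n\<close>, and dropping the first factor
    amounts to replacing \<open>m\<close> by \<open>Suc m\<close>.\<close>
  have diff: "fps_nth (\<Prod>i<Suc n. fps_recip_linear (real (m + 1 + i))) k = (B m - B (Suc m)) / real n" for m
    using arg_cong[OF prod_recip_linear_difference[of "\<lambda>i. real (m + 1 + i)" n], of "\<lambda>f. fps_nth f k"] assms
    by (simp add: B_def field_simps del: prod.lessThan_Suc)
  have "(\<Prod>i<n. fps_recip_linear (real (0 + 1 + i))) = (\<Prod>j=1..n. fps_recip_linear (real j))"
    by (rule prod.reindex_bij_witness[where i = "\<lambda>j. j - 1" and j = Suc]) (auto simp: add_ac)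
  hence "B 0 = P k (gen_harm n) / fact n"
    by (simp only: B_def prod_recip_linear_nth_eq_P)
  moreover have "B \<longlonglongrightarrow> 0"
    unfolding B_def using assms by (rule prod_recip_linear_tendsto_0)
  ultimately have "(\<lambda>m. B m - B (Suc m)) sums (P k (gen_harm n) / fact n)"
    using telescope_sums'[of B 0] by simp
  from sums_divide[OF this, of "real n"] show ?thesis
    unfolding diff by (simp add: mult.commute)
qed

text \<open>A coefficient of a product of \<open>r + 1\<close> series is a sum over compositions of
  \<open>q\<close> into \<open>r + 1\<close> parts. The extra \<open>1 / y r\<close> raises the last
  exponent to \<open>\<alpha> ! r + 2\<close>; the trailing ones give a constant.\<close>

lemma sum_compositions_eq_nth:
  fixes y :: "nat \<Rightarrow> real"
  assumes "r \<le> n"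
  shows "(\<Sum>\<alpha> \<in> {\<alpha> :: nat list. length \<alpha> = r + 1 \<and> sum_list \<alpha> = q}.
            1 / (\<Prod>i<Suc n. y i ^ ((map (\<lambda>i. \<alpha> ! i + 1) [0..<r] @ [\<alpha> ! r + 2] @ replicate (n - r) 1) ! i)))
         = fps_nth ((\<Prod>i<r. fps_recip_linear (y i)) * (fps_const (1 / y r) * fps_recip_linear (y r))
                    * fps_const (\<Prod>i\<in>{r<..n}. 1 / y i)) q"
    (is "?lhs = fps_nth (?F * fps_const ?c) q")
proof -
  define b where "b \<alpha> = map (\<lambda>i. \<alpha> ! i + 1) [0..<r] @ [\<alpha> ! r + 2] @ replicate (n - r) 1" for \<alpha> :: "nat list"
  define a where "a j = (if j = r then fps_const (1 / y r) * fps_recip_linear (y r) else fps_recip_linear (y j))" for j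
  have "1 / (\<Prod>i<Suc n. y i ^ (b \<alpha> ! i)) = (\<Prod>j=0..r. fps_nth (a j) (\<alpha> ! j)) * ?c" for \<alpha>
  proof -
    have "{..<Suc n} = {0..r} \<union> {r<..n}" using assms by auto
    hence "1 / (\<Prod>i<Suc n. y i ^ (b \<alpha> ! i))
             = (\<Prod>i\<in>{0..r} \<union> {r<..n}. 1 / y i ^ (b \<alpha> ! i))"
      by (simp add: prod_dividef)
    also have "\<dots> = (\<Prod>i=0..r. 1 / y i ^ (b \<alpha> ! i)) * (\<Prod>i\<in>{r<..n}. 1 / y i ^ (b \<alpha> ! i))"
      by (rule prod.union_disjoint) auto
    also have "(\<Prod>i=0..r. 1 / y i ^ (b \<alpha> ! i)) = (\<Prod>j=0..r. fps_nth (a j) (\<alpha> ! j))"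
      by (intro prod.cong) (auto simp: a_def b_def nth_append)
    also have "(\<Prod>i\<in>{r<..n}. 1 / y i ^ (b \<alpha> ! i)) = ?c"
      by (intro prod.cong) (auto simp: b_def nth_append nth_Cons')
    finally show ?thesis .
  qed
  hence "?lhs = (\<Sum>\<alpha>\<in>natpermute q (r + 1). \<Prod>j=0..r. fps_nth (a j) (\<alpha> ! j)) * ?c"
    by (simp add: b_def natpermute_def sum_distrib_right conj_commute cong: conj_cong)
  also have "(\<Sum>\<alpha>\<in>natpermute q (r + 1). \<Prod>j=0..r. fps_nth (a j) (\<alpha> ! j)) = fps_nth (\<Prod>j=0..r. a j) q"
    by (rule fps_prod_nth[symmetric])
  also have "(\<Prod>j=0..r. a j) = ?F"
    by (simp add: atLeast0AtMost a_def flip: lessThan_Suc_atMost)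
  finally show ?thesis by simp
qed

theorem theorem3p2:
  fixes n q :: nat
  assumes "n \<ge> 1"
  shows "(\<Sum>(r, s) \<in> {(r, s). r + s = n}.
            \<Sum>\<alpha> \<in> {\<alpha> :: nat list. length \<alpha> = r + 1 \<and> sum_list \<alpha> = q}.
              eta (map (\<lambda>i. \<alpha> ! i + 1) [0..<r] @ [\<alpha> ! r + 2] @ replicate s 1))
         = P (q + 1) (\<lambda>m. gen_harm n m) / (real n * fact n)"
proof -
  define b where "b r \<alpha> = map (\<lambda>i. \<alpha> ! i + 1) [0..<r] @ [\<alpha> ! r + 2] @ replicate (n - r) 1" for r and \<alpha> :: "nat list"
  define L where "L r = {\<alpha> :: nat list. length \<alpha> = r + 1 \<and> sum_list \<alpha> = q}" for r
  \<comment> \<open>Every argument list has \<open>n + 1\<close> entries, so all the series involve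
    the same linear factors and can be added termwise.\<close>
  have eta_sums: "(\<lambda>m. 1 / (\<Prod>i<Suc n. real (m + 1 + i) ^ (b r \<alpha> ! i))) sums eta (b r \<alpha>)"
    if "r \<le> n" for r \<alpha>
  proof -
    have len: "length (b r \<alpha>) = Suc n" using that by (simp add: b_def)
    \<comment> \<open>The entry \<open>\<alpha> ! r + 2\<close> alone secures convergence.\<close>
    have "sum_list (b r \<alpha>) > 1" by (simp add: b_def)
    from summable_sums[OF summable_eta[OF this]] show ?thesis
      by (simp only: eta_def len)
  qed
  have "(\<lambda>m. \<Sum>r\<le>n. \<Sum>\<alpha>\<in>L r. 1 / (\<Prod>i<Suc n. real (m + 1 + i) ^ (b r \<alpha> ! i)))
          sums (\<Sum>r\<le>n. \<Sum>\<alpha>\<in>L r. eta (b r \<alpha>))"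
    by (intro sums_sum eta_sums) auto
  moreover have "(\<Sum>r\<le>n. \<Sum>\<alpha>\<in>L r. 1 / (\<Prod>i<Suc n. real (m + 1 + i) ^ (b r \<alpha> ! i)))
      = fps_nth (\<Prod>i<Suc n. fps_recip_linear (real (m + 1 + i))) (Suc q)" for m
    unfolding b_def L_def
    by (subst sum_prod_recip_linear[symmetric]) (simp, intro sum.cong refl sum_compositions_eq_nth, simp)
  ultimately have "(\<Sum>r\<le>n. \<Sum>\<alpha>\<in>L r. eta (b r \<alpha>)) = P (Suc q) (gen_harm n) / (real n * fact n)"
    using sums_prod_recip_linear[of n "Suc q"] assms by (auto dest: sums_unique2)
  moreover have "(\<Sum>(r, s) \<in> {(r, s). r + s = n}. \<Sum>\<alpha>\<in>L r.
        eta (map (\<lambda>i. \<alpha> ! i + 1) [0..<r] @ [\<alpha> ! r + 2] @ replicate s 1))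
      = (\<Sum>r\<le>n. \<Sum>\<alpha>\<in>L r. eta (b r \<alpha>))"
    by (rule sum.reindex_bij_witness[where i = "\<lambda>r. (r, n - r)" and j = fst]) (auto simp: b_def)
  ultimately show ?thesis by (simp add: L_def)
qed

end
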